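(* Let $l$ and $n$ be positive integers and $\varepsilon\in\{1,-1\}$. Then the polynomial $$ \frac{1}{n}\sum_{k=0}^{n-1}\varepsilon^k (2k+1)^{2l-1}\sum_{j=0}^{k}{-x-1\choose j}^2{x\choose k-j}^2 $$ in $\mathbb{Q}[x]$ is integer-valued, i.e., it takes an integer value at every $x\in\mathbb{Z}$.
   Context: For a variable $x$ and a non-negative integer $k$, ${x\choose k}$ denotes the polynomial $x(x-1)\cdots(x-k+1)/k!$ (equal to $1$ for $k=0$), and ${-x-1\choose k}$ is this polynomial evaluated at $-x-1$. A polynomial $P(x)\in\mathbb{Q}[x]$ is called integer-valued if $P(x)\in\mathbb{Z}$ for all $x\in\mathbb{Z}$. *)

theory Defs
  imports "HOL-Computational_Algebra.Polynomial"
begin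

text \<open>
  The library's \<^const>\<open>gbinomial\<close> is by default constrained to fields of characteristic zero, so it
  does not apply to polynomials directly. The following is \<open>x (x - 1) \<cdots> (x - k + 1) / k!\<close> as an
  element of the rational polynomial ring; the lemma relates its values to \<^const>\<open>gbinomial\<close>.
\<close>

definition binomial_poly :: "nat \<Rightarrow> rat poly" where
  "binomial_poly k = smult (1 / fact k) (\<Prod>i<k. [:- of_nat i, 1:])"

lemma poly_binomial_poly: "poly (binomial_poly k) x = x gchoose k"
  by (simp add: binomial_poly_def gbinomial_prod_rev poly_prod lessThan_atLeast0)

definition integer_valued :: "rat poly \<Rightarrow> bool" where
  "integer_valued p \<longleftrightarrow> (\<forall>m::int. poly p (of_int m) \<in> \<int>)"

end

(* The inner sum has the expansion
     sum_j C(-x-1,j)^2 C(x,k-j)^2 = sum_m C(k,m) C(k+m,m) C(x,m) C(x+m,m),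
   because both sides satisfy the same three-term recurrence in k. For the left side, the recurrence
   comes from a third-order differential equation: its generating function is a product of two
   hypergeometric series, each with a second-order equation, linked by Euler's transformation
   (used here as a Wronskian relation). Integrality then reduces to
   n | sum_{k<n} eps^k (2k+1)^(2i+1) C(k,m) C(k+m,m) for all m. Multiplying C(k,m) C(k+m,m)
   by (2k+1)^2 gives an integer combination of itself and its neighbour m+1, which reduces
   everything to i = 0, where the sum has a closed form. *)

theory Submission
  imports Defs "HOL-Computational_Algebra.Formal_Power_Series"
begin

section \<open>The products C(x,m) C(x+m,m) and their recurrences in m and x\<close>

definition gbinom_pair :: "'a::field_char_0 \<Rightarrow> nat \<Rightarrow> 'a" where
  "gbinom_pair x m = (x gchoose m) * ((x + of_nat m) gchoose m)"

lemma gbinom_pair_0 [simp]: "gbinom_pair x 0 = 1"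
  by (simp add: gbinom_pair_def)

lemma gbinom_pair_of_nat: "gbinom_pair (of_nat n) m = of_nat ((n choose m) * ((n + m) choose m))"
  by (simp add: gbinom_pair_def binomial_gbinomial)

lemma gbinom_pair_of_int_in_Ints: "gbinom_pair (of_int t :: 'a::field_char_0) m \<in> \<int>"
proof -
  have "(of_int a :: 'a) gchoose m \<in> \<int>" for a
    unfolding of_int_gbinomial[symmetric] by (rule Ints_of_int)
  from this[of t] this[of "t + int m"] show ?thesis
    by (simp add: gbinom_pair_def)
qed

text \<open>Since (x - m)(x + m + 1) = x(x+1) - m(m+1), the product is a polynomial in x(x+1); this
  is how \<open>l\<close> enters the recurrence for the sums.\<close>

lemma gbinom_pair_Suc:
  "(of_nat m + 1)\<^sup>2 * gbinom_pair x (Suc m) = (x - of_nat m) * (x + of_nat m + 1) * gbinom_pair x m"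
proof -
  have 1: "(of_nat m + 1) * (x gchoose Suc m) = (x - of_nat m) * (x gchoose m)"
    using gbinomial_mult_1[of x m] by (simp add: algebra_simps)
  have 2: "(of_nat m + 1) * ((x + of_nat (Suc m)) gchoose Suc m)
      = (x + of_nat m + 1) * ((x + of_nat m) gchoose m)"
    using gbinomial_absorption[of m "x + of_nat (Suc m)"] by (simp add: algebra_simps)
  show ?thesis
    using arg_cong2[OF 1 2, of "(*)"] by (simp add: gbinom_pair_def power2_eq_square mult_ac)
qed

text \<open>Absorption in each binomial factor. The cross-multiplied form stays valid at x + 1 =
  m.\<close>

lemma gbinom_pair_shift:
  "(x + 1 - of_nat m) * gbinom_pair (x + 1) m = (x + 1 + of_nat m) * gbinom_pair x m"
proof -
  have 1: "(x + 1 - of_nat m) * ((x + 1) gchoose m) = (x + 1) * (x gchoose m)"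
    using gbinomial_absorb_comp[of "x + 1" m] by simp
  have 2: "(x + 1) * ((x + 1 + of_nat m) gchoose m) = (x + 1 + of_nat m) * ((x + of_nat m) gchoose m)"
    using gbinomial_absorb_comp[of "x + 1 + of_nat m" m] by simp
  have "(x + 1 - of_nat m) * gbinom_pair (x + 1) m
      = ((x + 1) * (x gchoose m)) * ((x + 1 + of_nat m) gchoose m)"
    unfolding gbinom_pair_def 1[symmetric] by (simp add: mult_ac)
  also have "\<dots> = (x + 1 + of_nat m) * gbinom_pair x m"
    using 2 by (simp add: gbinom_pair_def mult_ac)
  finally show ?thesis .
qed

text \<open>All three values at \<open>Suc k\<close> are polynomial multiples of \<open>gbinom_pair (y + 1) k / (k + 1)\<^sup>2\<close>.\<close>
lemma gbinom_pair_three_term: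
  fixes y :: "'a::field_char_0"
  shows "(y + 2)^3 * gbinom_pair (y + 2) (Suc k) + (y + 1)^3 * gbinom_pair y (Suc k)
    = (2 * y + 3) * (((y + 1)\<^sup>2 + (y + 2) + 2 * ((of_nat k + 1) * (of_nat k + 2))) * gbinom_pair (y + 1) (Suc k)
        + 2 * (of_nat k + 1)\<^sup>2 * gbinom_pair (y + 1) k)" (is "?l = ?r")
proof -
  define K where "K = (of_nat k :: 'a)"
  define T where "T = gbinom_pair (y + 1) k"
  have nz: "K + 1 \<noteq> 0"
    unfolding K_def by (metis of_nat_Suc of_nat_neq_0 add.commute)
  \<comment> \<open>The factor y + 2 - k coming from \<open>gbinom_pair_Suc\<close> is what
    \<open>gbinom_pair_shift\<close> absorbs to pass from y + 2 to y + 1; for y itself the factor y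
    + 1 + k does the same.\<close>
  have 1: "(K + 1)\<^sup>2 * gbinom_pair (y + 2) (Suc k) = (y + K + 3) * (y + K + 2) * T"
  proof -
    have "(K + 1)\<^sup>2 * gbinom_pair (y + 2) (Suc k)
      = (y + K + 3) * ((y + 1 + 1 - of_nat k) * gbinom_pair (y + 1 + 1) k)"
      using gbinom_pair_Suc[of k "y + 2"] by (simp add: K_def algebra_simps)
    then show ?thesis
      unfolding gbinom_pair_shift[of "y + 1" k] by (simp add: K_def T_def algebra_simps)
  qed
  have 2: "(K + 1)\<^sup>2 * gbinom_pair (y + 1) (Suc k) = (y + 1 - K) * (y + K + 2) * T"
    using gbinom_pair_Suc[of k "y + 1"] by (simp add: K_def T_def algebra_simps)
  have 3: "(K + 1)\<^sup>2 * gbinom_pair y (Suc k) = (y - K) * (y + 1 - K) * T"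
  proof -
    have "(K + 1)\<^sup>2 * gbinom_pair y (Suc k) = (y - K) * ((y + 1 + of_nat k) * gbinom_pair y k)"
      using gbinom_pair_Suc[of k y] by (simp add: K_def algebra_simps)
    then show ?thesis
      unfolding gbinom_pair_shift[of y k, symmetric] by (simp add: K_def T_def algebra_simps)
  qed
  have "(K + 1)\<^sup>2 * ?l = (y + 2)^3 * ((K + 1)\<^sup>2 * gbinom_pair (y + 2) (Suc k))
      + (y + 1)^3 * ((K + 1)\<^sup>2 * gbinom_pair y (Suc k))"
    by (simp add: algebra_simps)
  also have "\<dots> = (2 * y + 3) * (((y + 1)\<^sup>2 + (y + 2) + 2 * ((K + 1) * (K + 2)))
        * ((y + 1 - K) * (y + K + 2) * T) + 2 * (K + 1)\<^sup>2 * ((K + 1)\<^sup>2 * T))"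
    unfolding 1 3 by algebra
  also have "\<dots> = (K + 1)\<^sup>2 * ?r"
    unfolding 2[symmetric] by (simp add: K_def T_def algebra_simps)
  finally show ?thesis
    using nz by simp
qed

section \<open>Recurrence for sums that specialise at x = n to the Apery numbers of zeta(3)\<close>

definition apery_sum :: "'a::field_char_0 \<Rightarrow> nat \<Rightarrow> 'a" where
  "apery_sum x n = (\<Sum>m\<le>n. gbinom_pair (of_nat n) m * gbinom_pair x m)"

text \<open>C(n,m) vanishes for m > n, so sums with different n can be compared term by term over
  one range.\<close>

lemma apery_sum_extend:
  assumes "n \<le> N"
  shows "apery_sum x n = (\<Sum>m\<le>N. gbinom_pair (of_nat n) m * gbinom_pair x m)"
  unfolding apery_sum_def using assms
  by (intro sum.mono_neutral_left) (auto simp: gbinom_pair_of_nat)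

text \<open>Termwise use of \<open>gbinom_pair_three_term\<close>: its last summand, times the
  x-factor at k + 1, moves back to index k by \<open>gbinom_pair_Suc\<close>. After reindexing, the
  k-dependent coefficients cancel and only 2 l remains.\<close>

lemma apery_sum_rec:
  fixes x :: "'a::field_char_0"
  defines "l \<equiv> x * (x + 1)"
  shows "(of_nat n + 2)^3 * apery_sum x (Suc (Suc n))
    = (2 * of_nat n + 3) * ((of_nat n + 1)\<^sup>2 + (of_nat n + 2) + 2 * l) * apery_sum x (Suc n)
      - (of_nat n + 1)^3 * apery_sum x n"
proof -
  define y where "y = (of_nat n :: 'a)"
  define b where "b = gbinom_pair (y + 1)"
  define e where "e = gbinom_pair x"
  define c where "c = (y + 1)\<^sup>2 + (y + 2)"
  have e_Suc: "(of_nat m + 1)\<^sup>2 * e (Suc m) = (l - of_nat m * (of_nat m + 1)) * e m" for m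
    unfolding e_def gbinom_pair_Suc by (simp add: l_def algebra_simps)
  \<comment> \<open>C(n+1,n+2) = 0 removes the top term of the reindexed sum.\<close>
  have b0: "b (Suc (Suc n)) = 0"
    using gbinom_pair_of_nat[of "Suc n" "Suc (Suc n)", where 'a = 'a]
    by (simp add: b_def y_def add_ac binomial_eq_0 del: binomial_Suc_Suc)
  have yy: "of_nat (Suc (Suc n)) = y + 2" "of_nat (Suc n) = y + 1" "of_nat n = y"
    by (simp_all add: y_def)
  have "(y + 2)^3 * apery_sum x (Suc (Suc n)) + (y + 1)^3 * apery_sum x n
      = (\<Sum>m\<le>Suc (Suc n). ((y + 2)^3 * gbinom_pair (y + 2) m + (y + 1)^3 * gbinom_pair y m) * e m)"
    by (simp only: apery_sum_extend[of n "Suc (Suc n)"] apery_sum_extend[of "Suc (Suc n)" "Suc (Suc n)"]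
        yy e_def le_SucI order_refl sum_distrib_left sum.distrib ring_distribs mult.assoc)
  \<comment> \<open>The three-term relation covers only successors, so m = 0 is split off.\<close>
  also have "\<dots> = ((y + 2)^3 + (y + 1)^3) * e 0
      + (\<Sum>k\<le>Suc n. ((y + 2)^3 * gbinom_pair (y + 2) (Suc k) + (y + 1)^3 * gbinom_pair y (Suc k)) * e (Suc k))"
    by (subst sum.atMost_Suc_shift) simp
  also have "(\<Sum>k\<le>Suc n. ((y + 2)^3 * gbinom_pair (y + 2) (Suc k) + (y + 1)^3 * gbinom_pair y (Suc k)) * e (Suc k))
     = (\<Sum>k\<le>Suc n. (2 * y + 3) * ((c + 2 * (of_nat (Suc k) * (of_nat (Suc k) + 1))) * b (Suc k) * e (Suc k)
        + 2 * (l - of_nat k * (of_nat k + 1)) * b k * e k))"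
  proof (rule sum.cong[OF refl])
    fix k
    show "((y + 2)^3 * gbinom_pair (y + 2) (Suc k) + (y + 1)^3 * gbinom_pair y (Suc k)) * e (Suc k)
      = (2 * y + 3) * ((c + 2 * (of_nat (Suc k) * (of_nat (Suc k) + 1))) * b (Suc k) * e (Suc k)
        + 2 * (l - of_nat k * (of_nat k + 1)) * b k * e k)"
      unfolding gbinom_pair_three_term b_def[symmetric] c_def[symmetric]
      using e_Suc[of k] by (simp add: algebra_simps) algebra
  qed
  \<comment> \<open>A sum of cubes factors as (2y + 3) c, so the split-off term fills the slot k = 0
    of the first sum.\<close>
  also have "((y + 2)^3 + (y + 1)^3) * e 0 + \<dots>
     = (2 * y + 3) * ((c * b 0 * e 0
         + (\<Sum>k\<le>Suc n. (c + 2 * (of_nat (Suc k) * (of_nat (Suc k) + 1))) * b (Suc k) * e (Suc k)))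
       + (\<Sum>k\<le>Suc n. 2 * (l - of_nat k * (of_nat k + 1)) * b k * e k))"
  proof -
    have "(y + 2)^3 + (y + 1)^3 = (2 * y + 3) * c"
      unfolding c_def by algebra
    then show ?thesis
      by (simp only: b_def gbinom_pair_0 sum_distrib_left[symmetric] sum.distrib) (simp add: algebra_simps)
  qed
  also have "c * b 0 * e 0
         + (\<Sum>k\<le>Suc n. (c + 2 * (of_nat (Suc k) * (of_nat (Suc k) + 1))) * b (Suc k) * e (Suc k))
      = (\<Sum>k\<le>Suc (Suc n). (c + 2 * (of_nat k * (of_nat k + 1))) * b k * e k)"
    by (subst sum.atMost_Suc_shift[of _ "Suc n"]) simp
  also have "\<dots> = (\<Sum>k\<le>Suc n. (c + 2 * (of_nat k * (of_nat k + 1))) * b k * e k)"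
    by (subst sum.atMost_Suc) (simp only: b0, simp)
  \<comment> \<open>The terms 2k(k+1) of the two sums cancel here.\<close>
  also have "\<dots> + (\<Sum>k\<le>Suc n. 2 * (l - of_nat k * (of_nat k + 1)) * b k * e k)
      = (c + 2 * l) * apery_sum x (Suc n)"
    unfolding apery_sum_def yy b_def[symmetric] e_def[symmetric] sum.distrib[symmetric] sum_distrib_left
    by (intro sum.cong) (simp_all add: algebra_simps)
  finally show ?thesis
    by (simp add: y_def c_def algebra_simps)
qed

section \<open>Differential equations for generating functions of squared binomials\<close>

definition fps_theta :: "'a::field_char_0 fps \<Rightarrow> 'a fps" where
  "fps_theta f = fps_X * fps_deriv f"

text \<open>The reason for using the Euler operator: recurrences with coefficients polynomial in n
  become differential equations with coefficients polynomial in X.\<close>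

lemma fps_theta_nth [simp]: "fps_nth (fps_theta f) n = of_nat n * fps_nth f n"
  by (cases n) (simp_all add: fps_theta_def)

lemma fps_theta_simps:
  "fps_theta (f + g) = fps_theta f + fps_theta g"
  "fps_theta (f - g) = fps_theta f - fps_theta g"
  "fps_theta (f * g) = fps_theta f * g + f * fps_theta g"
  "fps_theta (fps_const c) = 0"
  "fps_theta fps_X = fps_X"
  "fps_theta 1 = 0"
  "fps_theta (numeral k) = 0"
  by (simp_all add: fps_theta_def algebra_simps)

text \<open>In characteristic 0 the kernel of the Euler operator consists of the constants.\<close>

lemma fps_theta_eq_0_imp_eq_0:
  assumes "fps_theta f = 0" "fps_nth f 0 = 0"
  shows "f = 0"
proof (rule fps_ext)
  fix n
  have "of_nat n * fps_nth f n = 0"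
    using assms(1) by (metis fps_theta_nth fps_zero_nth)
  with assms(2) show "fps_nth f n = fps_nth 0 n"
    by (cases n) (simp_all del: of_nat_Suc)
qed

text \<open>The hypergeometric series 2F1(-x,-x;1;X).\<close>

definition gbinom_sq_fps :: "'a::field_char_0 \<Rightarrow> 'a fps" where
  "gbinom_sq_fps x = Abs_fps (\<lambda>j. (x gchoose j)\<^sup>2)"

text \<open>Squaring (j+1) C(x,j+1) = (x-j) C(x,j) gives theta^2 u = X (theta - x)^2 u, with theta
  the Euler operator.\<close>

lemma gbinom_sq_fps_ode:
  fixes x :: "'a::field_char_0"
  defines "u \<equiv> gbinom_sq_fps x"
  shows "(1 - fps_X) * fps_theta (fps_theta u)
    = fps_X * ((fps_const x)\<^sup>2 * u - 2 * fps_const x * fps_theta u)"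
proof -
  have "fps_theta (fps_theta u) = fps_X * (fps_theta (fps_theta u) - 2 * fps_const x * fps_theta u + fps_const (x\<^sup>2) * u)"
  proof (rule fps_ext)
    fix n
    show "fps_nth (fps_theta (fps_theta u)) n
      = fps_nth (fps_X * (fps_theta (fps_theta u) - 2 * fps_const x * fps_theta u + fps_const (x\<^sup>2) * u)) n"
    proof (cases n)
      case (Suc m)
      have "(of_nat m + 1) * (x gchoose Suc m) = (x - of_nat m) * (x gchoose m)"
        using gbinomial_mult_1[of x m] by (simp add: algebra_simps)
      then have "((of_nat m + 1) * (x gchoose Suc m))\<^sup>2 = ((x - of_nat m) * (x gchoose m))\<^sup>2"
        by simp
      then show ?thesis
        by (simp add: Suc u_def gbinom_sq_fps_def power2_eq_square numeral_fps_const mult.assoc algebra_simps)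
    qed simp
  qed
  moreover have "fps_const (x\<^sup>2) = (fps_const x)\<^sup>2"
    by simp
  ultimately show ?thesis
    by algebra
qed

lemma gbinom_sq_fps_reflected_ode:
  fixes x :: "'a::field_char_0"
  defines "u \<equiv> gbinom_sq_fps (- x - 1)"
  shows "(1 - fps_X) * fps_theta (fps_theta u)
    = fps_X * ((fps_const x + 1)\<^sup>2 * u + 2 * (fps_const x + 1) * fps_theta u)"
proof -
  have "fps_const (- x - 1) = - fps_const x - 1"
    by (simp flip: fps_const_neg fps_const_sub)
  then show ?thesis
    using gbinom_sq_fps_ode[of "- x - 1"] unfolding u_def by algebra
qed

text \<open>
  If \<open>W\<close> is the left-hand side divided by \<open>X\<close>, i.e. the Wronskian form with \<open>d/dX\<close> in place
  of \<open>X d/dX\<close>, the two equations give \<open>X W' = - W\<close>; hence the left-hand side is constant.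
\<close>
lemma gbinom_sq_fps_wronskian:
  fixes x :: "'a::field_char_0"
  defines "u \<equiv> gbinom_sq_fps (- x - 1)" and "v \<equiv> gbinom_sq_fps x"
  shows "(1 - fps_X) * (u * fps_theta v - fps_theta u * v) + fps_const (2 * x + 1) * fps_X * (u * v) = 0"
    (is "?W = 0")
proof (rule fps_theta_eq_0_imp_eq_0)
  define c where "c = fps_const x"
  have U: "(1 - fps_X) * fps_theta (fps_theta u) = fps_X * ((c + 1)^2 * u + 2 * (c + 1) * fps_theta u)"
    unfolding u_def c_def by (rule gbinom_sq_fps_reflected_ode)
  have V: "(1 - fps_X) * fps_theta (fps_theta v) = fps_X * (c^2 * v - 2 * c * fps_theta v)"
    unfolding v_def c_def by (rule gbinom_sq_fps_ode)
  have "fps_const (2 * x + 1) = 2 * c + 1"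
    by (simp add: c_def numeral_fps_const flip: fps_const_mult fps_const_add)
  moreover have "fps_theta c = 0"
    by (simp add: c_def fps_theta_simps)
  ultimately show "fps_theta ?W = 0"
    using U V unfolding fps_theta_simps by simp algebra
  show "fps_nth ?W 0 = 0"
    by simp
qed

text \<open>A product of solutions of two second-order equations generally needs order 4; the
  Wronskian relation cuts this to 3. With theta the Euler operator, the equation is theta^3 y - X (2
  theta + 1)(theta^2 + theta + 1 + 2L) y + X^2 (theta + 1)^3 y = 0.\<close>

lemma gbinom_sq_fps_prod_ode:
  fixes x :: "'a::field_char_0"
  defines "y \<equiv> gbinom_sq_fps (- x - 1) * gbinom_sq_fps x"
    and "L \<equiv> fps_const (x * (x + 1))"
  shows "fps_theta (fps_theta (fps_theta y))
    - fps_X * (2 * fps_theta (fps_theta (fps_theta y)) + 3 * fps_theta (fps_theta y)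
        + (3 + 4 * L) * fps_theta y + (1 + 2 * L) * y)
    + fps_X\<^sup>2 * (fps_theta (fps_theta (fps_theta y)) + 3 * fps_theta (fps_theta y)
        + 3 * fps_theta y + y) = 0"
proof -
  define c where "c = fps_const x"
  define z where "z = (fps_X :: 'a fps)"
  define s where "s = 1 - z"
  define u where "u = gbinom_sq_fps (- x - 1)"
  define v where "v = gbinom_sq_fps x"
  define u1 where "u1 = fps_theta u"
  define v1 where "v1 = fps_theta v"
  define y1 where "y1 = fps_theta y"
  define y2 where "y2 = fps_theta y1"
  define y3 where "y3 = fps_theta y2"
  define q where "q = u1 * v1"
  define q1 where "q1 = fps_theta q"
  have U: "s * fps_theta u1 = z * ((c + 1)^2 * u + 2 * (c + 1) * u1)"
    unfolding u_def u1_def s_def z_def c_def by (rule gbinom_sq_fps_reflected_ode)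
  have V: "s * fps_theta v1 = z * (c^2 * v - 2 * c * v1)"
    unfolding v_def v1_def s_def z_def c_def by (rule gbinom_sq_fps_ode)
  have c: "fps_const (2 * x + 1) = 2 * c + 1"
    by (simp add: c_def numeral_fps_const flip: fps_const_mult fps_const_add)
  have W: "s * (u * v1 - u1 * v) = - (2 * c + 1) * z * y"
    using gbinom_sq_fps_wronskian[of x] unfolding c
    by (simp add: y_def u_def v_def u1_def v1_def s_def z_def algebra_simps add_eq_0_iff)
  have th: "fps_theta c = 0" "fps_theta z = z" "fps_theta s = - z"
    by (simp_all add: c_def z_def s_def fps_theta_simps)
  have y: "y = u * v"
    by (simp add: y_def u_def v_def)
  have y1: "y1 = u1 * v + u * v1"
    by (simp add: y1_def y u1_def v1_def fps_theta_simps)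
  have y2: "s * y2 = 2 * s * q + z * (2 * (c + 1) * (u1 * v) - 2 * c * (u * v1) + (c^2 + (c + 1)^2) * y)"
  proof -
    have "y2 = fps_theta u1 * v + 2 * q + u * fps_theta v1"
      unfolding y2_def y1 fps_theta_simps u1_def[symmetric] v1_def[symmetric] q_def by algebra
    then show ?thesis
      using U V y by algebra
  qed
  have q1: "s * q1 = z * (2 * q + (c + 1)^2 * (u * v1) + c^2 * (u1 * v))"
    unfolding q1_def q_def fps_theta_simps using U V by algebra
  \<comment> \<open>A further factor s lets \<open>W\<close> replace u1 v and u v1 by y and y1,
    leaving q as the only other product.\<close>
  have eq2: "s^2 * y2 = 2 * s^2 * q + z * s * y1 + z^2 * (2 * c + 1)^2 * y + z * s * (c^2 + (c + 1)^2) * y"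
    using y2 W y1 by algebra
  have "fps_theta (s^2 * y2) = fps_theta (2 * s^2 * q + z * s * y1 + z^2 * (2 * c + 1)^2 * y + z * s * (c^2 + (c + 1)^2) * y)"
    by (simp only: eq2)
  then have eq3: "s^2 * y3 - 2 * z * s * y2 = 2 * s^2 * q1 - 4 * z * s * q
     + z * s * y1 - z^2 * y1 + z * s * y2 + (2 * z^2 * y + z^2 * y1) * (2 * c + 1)^2
     + (z * s * y - z^2 * y + z * s * y1) * (c^2 + (c + 1)^2)"
    unfolding fps_theta_simps power2_eq_square th y3_def[symmetric] y2_def[symmetric] y1_def[symmetric]
      q1_def[symmetric] by algebra
  \<comment> \<open>The left side is \<open>fps_theta (2 * s^2 * q)\<close>: the 2q inside
    \<open>q1\<close> cancels -4zsq, so q drops out.\<close>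
  have eq4: "2 * s^2 * q1 - 4 * z * s * q = z * s * (c^2 + (c + 1)^2) * y1 - z^2 * (2 * c + 1)^2 * y"
    using q1 W y1 by algebra
  \<comment> \<open>Substituting s = 1 - z and sorting by powers of z suffices; no division by s is
    involved.\<close>
  have "y3 - z * (2 * y3 + 3 * y2 + (3 + 4 * (c * (c + 1))) * y1 + (1 + 2 * (c * (c + 1))) * y)
    + z^2 * (y3 + 3 * y2 + 3 * y1 + y) = 0"
    using eq3 eq4 s_def by algebra
  moreover have "L = c * (c + 1)"
    by (simp add: L_def c_def flip: fps_const_mult fps_const_add)
  ultimately show ?thesis
    by (simp add: y3_def y2_def y1_def z_def)
qed

section \<open>The convolution of squared binomials and its expansion\<close>

definition gbinom_sq_conv :: "'a::field_char_0 \<Rightarrow> nat \<Rightarrow> 'a" where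
  "gbinom_sq_conv x n = (\<Sum>j = 0..n. ((- x - 1) gchoose j)\<^sup>2 * (x gchoose (n - j))\<^sup>2)"

lemma gbinom_sq_conv_eq_nth:
  "gbinom_sq_conv x n = fps_nth (gbinom_sq_fps (- x - 1) * gbinom_sq_fps x) n"
  by (simp add: gbinom_sq_conv_def fps_mult_nth gbinom_sq_fps_def)

text \<open>Coefficient of X^(n+2) in \<open>gbinom_sq_fps_prod_ode\<close>: the Euler operator acts
  as n+2, n+1 and n on the parts with X^0, X^1 and X^2.\<close>

lemma gbinom_sq_conv_rec:
  fixes x :: "'a::field_char_0"
  defines "l \<equiv> x * (x + 1)"
  shows "(of_nat n + 2)^3 * gbinom_sq_conv x (Suc (Suc n))
    = (2 * of_nat n + 3) * ((of_nat n + 1)\<^sup>2 + (of_nat n + 2) + 2 * l) * gbinom_sq_conv x (Suc n)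
      - (of_nat n + 1)^3 * gbinom_sq_conv x n"
proof -
  define y where "y = gbinom_sq_fps (- x - 1) * gbinom_sq_fps x"
  have *: "fps_nth (fps_theta (fps_theta (fps_theta y))
    - fps_X * (2 * fps_theta (fps_theta (fps_theta y)) + 3 * fps_theta (fps_theta y)
        + (3 + 4 * fps_const l) * fps_theta y + (1 + 2 * fps_const l) * y)
    + fps_X\<^sup>2 * (fps_theta (fps_theta (fps_theta y)) + 3 * fps_theta (fps_theta y)
        + 3 * fps_theta y + y)) (Suc (Suc n)) = 0"
    using gbinom_sq_fps_prod_ode[of x] by (simp add: y_def l_def)
  have nth_X2: "fps_nth (fps_X\<^sup>2 * f) (Suc (Suc n)) = fps_nth f n" for f :: "'a fps"
    by (simp add: power2_eq_square mult.assoc)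
  show ?thesis
    using * unfolding gbinom_sq_conv_eq_nth y_def[symmetric]
    by (simp add: nth_X2 numeral_fps_const ring_distribs mult.assoc flip: fps_const_mult fps_const_add) algebra
qed

text \<open>Same recurrence with nonzero leading coefficient (n+2)^3, and the same values 1 and 1 +
  2x(x+1) at n = 0 and n = 1.\<close>

lemma gbinom_sq_conv_eq_apery_sum: "gbinom_sq_conv x n = apery_sum x n"
proof (induction n rule: induct_nat_012)
  case 0
  show ?case by (simp add: gbinom_sq_conv_def apery_sum_def)
next
  case 1
  show ?case
    by (simp add: gbinom_sq_conv_def apery_sum_def gbinom_pair_def power2_eq_square algebra_simps)
next
  case (ge2 n)
  have "(of_nat n + 2 :: 'a)^3 \<noteq> 0"
    by (metis add_2_eq_Suc' of_nat_Suc of_nat_neq_0 of_nat_add of_nat_numeral power_not_zero)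
  moreover have "(of_nat n + 2)^3 * gbinom_sq_conv x (Suc (Suc n)) = (of_nat n + 2)^3 * apery_sum x (Suc (Suc n))"
    by (simp only: gbinom_sq_conv_rec apery_sum_rec ge2)
  ultimately show ?case
    by simp
qed

section \<open>Divisibility by n of weighted sums over the integers\<close>

definition int_pair :: "nat \<Rightarrow> nat \<Rightarrow> int" where
  "int_pair k m = int ((k choose m) * ((k + m) choose m))"

lemma int_pair_Suc:
  "(int m + 1)\<^sup>2 * int_pair k (Suc m) = (int k - int m) * (int k + int m + 1) * int_pair k m"
proof -
  have "rat_of_int ((int m + 1)\<^sup>2 * int_pair k (Suc m))
    = rat_of_int ((int k - int m) * (int k + int m + 1) * int_pair k m)"
    using gbinom_pair_Suc[of m "rat_of_nat k"]
    by (simp add: gbinom_pair_of_nat int_pair_def del: binomial_Suc_Suc add_Suc_right)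
  then show ?thesis
    by (simp only: of_int_eq_iff)
qed

text \<open>Supplies the base case for \<epsilon> = 1: the closed form displays the factor
  n.\<close>

lemma sum_odd_int_pair:
  "(\<Sum>k<n. (2 * int k + 1) * int_pair k m) = int n * int ((n choose Suc m) * ((n + m) choose m))"
proof (induction n)
  case (Suc n)
  define a where "a = int (n choose m)"
  define b where "b = int ((n + m) choose m)"
  \<comment> \<open>All binomials are reduced to a and b; the first two relations need the factor m
    + 1, which is cancelled at the end.\<close>
  have 1: "(int m + 1) * int (n choose Suc m) = (int n - int m) * a"
  proof -
    have "rat_of_int ((int m + 1) * int (n choose Suc m)) = rat_of_int ((int n - int m) * a)"
      using gbinomial_mult_1[of "rat_of_nat n" m]
      by (simp add: a_def binomial_gbinomial algebra_simps)
    then show ?thesis by (simp only: of_int_eq_iff)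
  qed
  have 2: "(int m + 1) * int (Suc n choose Suc m) = (int n + 1) * a"
    using arg_cong[OF Suc_times_binomial[of m n], of int]
    by (simp add: a_def algebra_simps del: binomial_Suc_Suc)
  have 3: "(int n + 1) * int ((Suc n + m) choose m) = (int n + int m + 1) * b"
    using arg_cong[OF binomial_absorb_comp[of "Suc n + m" m], of int]
    by (simp add: b_def algebra_simps del: binomial_Suc_Suc)
  have "(int m + 1) * (int n * (int (n choose Suc m) * b) + (2 * int n + 1) * (a * b))
    = (int m + 1) * (int (Suc n) * (int (Suc n choose Suc m) * int ((Suc n + m) choose m)))"
    using 1 2 3 unfolding of_nat_Suc by algebra
  then have "int n * (int (n choose Suc m) * b) + (2 * int n + 1) * (a * b)
    = int (Suc n) * (int (Suc n choose Suc m) * int ((Suc n + m) choose m))"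
    by (subst (asm) mult_cancel_left) auto
  then show ?case
    by (simp only: sum.lessThan_Suc Suc.IH) (simp only: int_pair_def of_nat_mult a_def b_def)
qed simp

text \<open>Telescoping: writing P(n) for \<open>int_pair n m\<close>, the shift relation turns
  (n+1-m) P(n+1) into (n+1+m) P(n), and (n+1+m) + (n-m) = 2n+1.\<close>

lemma sum_alternating_odd_int_pair:
  "(\<Sum>k<n. (- 1) ^ k * (2 * int k + 1) * int_pair k m)
    = - ((- 1) ^ n * (int n - int m) * int_pair n m)"
proof (induction n)
  case 0
  \<comment> \<open>The boundary term vanishes at n = 0: by the factor n - m if m = 0, by C(0,m)
    otherwise.\<close>
  show ?case by (cases m) (simp_all add: int_pair_def)
next
  case (Suc n)
  have "(int n + 1 - int m) * int_pair (Suc n) m = (int n + 1 + int m) * int_pair n m"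
  proof -
    have "rat_of_int ((int n + 1 - int m) * int_pair (Suc n) m)
      = rat_of_int ((int n + 1 + int m) * int_pair n m)"
      using gbinom_pair_shift[of "rat_of_nat n" m] gbinom_pair_of_nat[of "Suc n" m, where 'a = rat]
      by (simp add: gbinom_pair_of_nat int_pair_def add.commute del: binomial_Suc_Suc)
    then show ?thesis by (simp only: of_int_eq_iff)
  qed
  moreover define s :: int where "s = (- 1) ^ n"
  ultimately show ?case
    unfolding sum.lessThan_Suc Suc.IH power_Suc of_nat_Suc s_def[symmetric] by algebra
qed

text \<open>Absorption gives (n-m) C(n,m) = n C(n-1,m); both sides vanish for m > n.\<close>

lemma dvd_alternating_boundary: "int n dvd (int n - int m) * int_pair n m"
proof -
  have "(int n - int m) * int (n choose m) = int n * int ((n - 1) choose m)"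
  proof (cases "m \<le> n")
    case True
    then show ?thesis
      using arg_cong[OF binomial_absorb_comp[of n m], of int] by (simp add: of_nat_diff)
  qed (simp add: binomial_eq_0)
  then show ?thesis
    unfolding int_pair_def of_nat_mult mult.assoc[symmetric] by simp
qed

text \<open>By (2k+1)^2 = (2m+1)^2 + 4(k-m)(k+m+1) and \<open>int_pair_Suc\<close>, lowering the
  exponent by 2 costs a step from m to m+1; hence the induction runs over all m at once.\<close>

lemma dvd_sum_odd_powers_int_pair:
  assumes "\<epsilon> \<in> {1, - 1 :: int}"
  shows "int n dvd (\<Sum>k<n. \<epsilon> ^ k * (2 * int k + 1) ^ (2 * i + 1) * int_pair k m)"
proof (induction i arbitrary: m)
  case 0
  show ?case
    using assms sum_odd_int_pair[of m n] sum_alternating_odd_int_pair[of m n]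
      dvd_alternating_boundary[of n m]
    by (auto simp: mult.assoc)
next
  case (Suc i)
  define f where "f j = (\<Sum>k<n. \<epsilon> ^ k * (2 * int k + 1) ^ (2 * i + 1) * int_pair k j)" for j
  have *: "(2 * int k + 1)\<^sup>2 * int_pair k m
      = (4 * int m * (int m + 1) + 1) * int_pair k m + 4 * (int m + 1)\<^sup>2 * int_pair k (Suc m)" for k
    using int_pair_Suc[of m k] by algebra
  have "\<epsilon> ^ k * (2 * int k + 1) ^ (2 * Suc i + 1) * int_pair k m
      = (4 * int m * (int m + 1) + 1) * (\<epsilon> ^ k * (2 * int k + 1) ^ (2 * i + 1) * int_pair k m)
        + 4 * (int m + 1)\<^sup>2 * (\<epsilon> ^ k * (2 * int k + 1) ^ (2 * i + 1) * int_pair k (Suc m))" for k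
  proof -
    have "\<epsilon> ^ k * (2 * int k + 1) ^ (2 * Suc i + 1) * int_pair k m
        = (\<epsilon> ^ k * (2 * int k + 1) ^ (2 * i + 1)) * ((2 * int k + 1)\<^sup>2 * int_pair k m)"
      by (simp add: power2_eq_square)
    then show ?thesis
      unfolding * by (simp only: ring_distribs mult_ac)
  qed
  then have "(\<Sum>k<n. \<epsilon> ^ k * (2 * int k + 1) ^ (2 * Suc i + 1) * int_pair k m)
      = (4 * int m * (int m + 1) + 1) * f m + 4 * (int m + 1)\<^sup>2 * f (Suc m)"
    by (simp only: f_def sum.distrib sum_distrib_left)
  then show ?case
    using Suc.IH[of m] Suc.IH[of "Suc m"] by (simp only: f_def[symmetric]) (intro dvd_add dvd_mult)
qed

section \<open>Integrality at every integer point\<close>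

theorem theorem1p2:
  fixes l n :: nat and \<epsilon> :: rat
  assumes "l > 0" and "n > 0" and "\<epsilon> \<in> {1, -1}"
  shows "integer_valued
    (smult (1 / of_nat n)
      (\<Sum>k = 0..n - 1. smult (\<epsilon> ^ k * (2 * of_nat k + 1) ^ (2 * l - 1))
        (\<Sum>j = 0..k. (pcompose (binomial_poly j) [:- 1, - 1:])\<^sup>2 * (binomial_poly (k - j))\<^sup>2)))"
  unfolding integer_valued_def
proof
  fix t :: int
  define x where "x = rat_of_int t"
  \<comment> \<open>l > 0 ensures that the truncated 2l - 1 is odd.\<close>
  obtain i where i: "2 * l - 1 = 2 * i + 1"
    using assms(1) by (cases l) auto
  obtain e :: int where e: "e \<in> {1, - 1}" "\<epsilon> = of_int e"
    using assms(3) by (metis insert_iff of_int_1 of_int_minus singletonD)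
  \<comment> \<open>The values are integers, so the floor changes only the type.\<close>
  define c where "c m = \<lfloor>gbinom_pair x m\<rfloor>" for m
  have c: "of_int (c m) = gbinom_pair x m" for m
    using gbinom_pair_of_int_in_Ints[of t m, where 'a = rat] unfolding c_def x_def
    by (elim Ints_cases) simp
  define S where "S = (\<Sum>m<n. c m * (\<Sum>k<n. e ^ k * (2 * int k + 1) ^ (2 * i + 1) * int_pair k m))"
  have range: "{0..n - 1} = {..<n}" "{..n - 1} = {..<n}"
    using assms(2) by auto
  have inner: "poly (\<Sum>j = 0..k. (pcompose (binomial_poly j) [:- 1, - 1:])\<^sup>2 * (binomial_poly (k - j))\<^sup>2) x
      = gbinom_sq_conv x k" for k
  proof -
    have "poly [:- 1, - 1:] x = - x - 1"
      by simp
    then show ?thesis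
      by (simp only: poly_sum poly_mult poly_power poly_pcompose poly_binomial_poly gbinom_sq_conv_def)
  qed
  have term_k: "\<epsilon> ^ k * (2 * of_nat k + 1) ^ (2 * i + 1) * gbinom_sq_conv x k
        = (\<Sum>m<n. of_int (c m * (e ^ k * (2 * int k + 1) ^ (2 * i + 1) * int_pair k m)))"
    if "k < n" for k
  proof -
    \<comment> \<open>Extending m \<le> k to m < n makes the inner range independent of k, so the
      two sums can be swapped.\<close>
    have "gbinom_sq_conv x k = (\<Sum>m<n. gbinom_pair (of_nat k) m * gbinom_pair x m)"
      using apery_sum_extend[of k "n - 1" x] that unfolding range gbinom_sq_conv_eq_apery_sum by simp
    also have "\<dots> = (\<Sum>m<n. of_int (c m * int_pair k m))"
      by (intro sum.cong refl) (simp only: of_int_mult c gbinom_pair_of_nat int_pair_def of_int_of_nat_eq mult.commute)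
    finally have "\<epsilon> ^ k * (2 * of_nat k + 1) ^ (2 * i + 1) * gbinom_sq_conv x k
        = of_int (e ^ k * (2 * int k + 1) ^ (2 * i + 1) * (\<Sum>m<n. c m * int_pair k m))"
      by (simp only: e(2) of_int_mult of_int_power of_int_add of_int_sum of_int_of_nat_eq of_int_numeral of_int_1)
    also have "e ^ k * (2 * int k + 1) ^ (2 * i + 1) * (\<Sum>m<n. c m * int_pair k m)
        = (\<Sum>m<n. c m * (e ^ k * (2 * int k + 1) ^ (2 * i + 1) * int_pair k m))"
      unfolding sum_distrib_left by (intro sum.cong refl) (simp only: mult_ac)
    finally show ?thesis
      by (simp only: of_int_sum)
  qed
  have "poly (\<Sum>k = 0..n - 1. smult (\<epsilon> ^ k * (2 * of_nat k + 1) ^ (2 * l - 1))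
        (\<Sum>j = 0..k. (pcompose (binomial_poly j) [:- 1, - 1:])\<^sup>2 * (binomial_poly (k - j))\<^sup>2)) x
    = (\<Sum>k<n. \<Sum>m<n. of_int (c m * (e ^ k * (2 * int k + 1) ^ (2 * i + 1) * int_pair k m)))"
    unfolding range i
    by (subst poly_sum) (simp only: poly_smult inner, intro sum.cong refl term_k, simp)
  also have "\<dots> = of_int S"
    by (subst sum.swap) (simp only: S_def of_int_sum sum_distrib_left)
  finally have poly_eq: "poly (\<Sum>k = 0..n - 1. smult (\<epsilon> ^ k * (2 * of_nat k + 1) ^ (2 * l - 1))
        (\<Sum>j = 0..k. (pcompose (binomial_poly j) [:- 1, - 1:])\<^sup>2 * (binomial_poly (k - j))\<^sup>2)) x = of_int S" .
  have "int n dvd S"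
    unfolding S_def by (intro dvd_sum dvd_mult dvd_sum_odd_powers_int_pair e(1))
  then obtain r where "S = int n * r" ..
  then have "1 / of_nat n * rat_of_int S = of_int r"
    using assms(2) by simp
  then show "poly (smult (1 / of_nat n)
      (\<Sum>k = 0..n - 1. smult (\<epsilon> ^ k * (2 * of_nat k + 1) ^ (2 * l - 1))
        (\<Sum>j = 0..k. (pcompose (binomial_poly j) [:- 1, - 1:])\<^sup>2 * (binomial_poly (k - j))\<^sup>2)))
      (of_int t) \<in> \<int>"
    unfolding poly_smult[of "1 / of_nat n"] x_def[symmetric] poly_eq by (simp only: Ints_of_int)
qed

end
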